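(* Let $\mathcal H$ be a real Hilbert space with norm $\|\cdot\|$. Let $\alpha,\varepsilon,\gamma\in\left]0,+\infty\right[$, and define $\varphi\colon\mathcal H\to\mathbb R$ by $\varphi=\alpha+\max(\|\cdot\|-\varepsilon,0)$. Then $$\widetilde\varphi\colon\mathbb R\times\mathcal H\to\left]-\infty,+\infty\right]\colon(\sigma,x)\mapsto\begin{cases}\alpha\sigma+\max(\|x\|-\varepsilon\sigma,0),&\text{if }\sigma\geq 0;\\ +\infty,&\text{if }\sigma<0.\end{cases}$$ Now let $\sigma\in\mathbb R$ and $x\in\mathcal H$. Then the following hold: (i) Suppose that $\sigma+\varepsilon\|x\|\leq\gamma\alpha$ and $\|x\|\leq\gamma$. Then $\operatorname{prox}_{\gamma\widetilde\varphi}(\sigma,x)=(0,0)$. (ii) Suppose that $\sigma\leq\gamma(\alpha-\varepsilon)$ and $\|x\|>\gamma$. Then $\operatorname{prox}_{\gamma\widetilde\varphi}(\sigma,x)=\Big(0,\Big(1-\dfrac{\gamma}{\|x\|}\Big)x\Big)$. (iii) Suppose that $\sigma>\gamma(\alpha-\varepsilon)$ and $\|x\|\geq\varepsilon\sigma+\gamma(1+\varepsilon(\varepsilon-\alpha))$. Then $\operatorname{prox}_{\gamma\widetilde\varphi}(\sigma,x)=\Big(\sigma+\gamma(\varepsilon-\alpha),\Big(1-\dfrac{\gamma}{\|x\|}\Big)x\Big)$. (iv) Suppose that $\sigma+\varepsilon\|x\|>\gamma\alpha$ and $\varepsilon(\sigma-\gamma\alpha)<\|x\|<\varepsilon\sigma+\gamma(1+\varepsilon(\varepsilon-\alpha))$.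 Then $$\operatorname{prox}_{\gamma\widetilde\varphi}(\sigma,x)=\frac{\sigma+\varepsilon\|x\|-\gamma\alpha}{1+\varepsilon^2}\Big(1,\frac{\varepsilon}{\|x\|}x\Big).$$ (v) Suppose that $\sigma\geq\gamma\alpha$ and $\|x\|\leq\varepsilon(\sigma-\gamma\alpha)$. Then $\operatorname{prox}_{\gamma\widetilde\varphi}(\sigma,x)=(\sigma-\gamma\alpha,x)$.
   Context: For a real Hilbert space $\mathcal H$, $\Gamma_0(\mathcal H)$ is the class of proper lower semicontinuous convex functions from $\mathcal H$ to $\left]-\infty,+\infty\right]$. For $\varphi\in\Gamma_0(\mathcal H)$: the recession function is $(\operatorname{rec}\varphi)(x)=\sup_{y\in\operatorname{dom}\varphi}(\varphi(x+y)-\varphi(y))$; the perspective of $\varphi$ is $\widetilde\varphi\colon\mathbb R\times\mathcal H\to\left]-\infty,+\infty\right]$ defined by $\widetilde\varphi(\sigma,x)=\sigma\varphi(x/\sigma)$ if $\sigma>0$, $\widetilde\varphi(0,x)=(\operatorname{rec}\varphi)(x)$, and $\widetilde\varphi(\sigma,x)=+\infty$ if $\sigma<0$. The space $\mathbb R\oplus\mathcal H$ is the Hilbert direct sum, with $\langle(\sigma,x)\mid(\tau,y)\rangle=\sigma\tau+\langle x\mid y\rangle$. For $f\in\Gamma_0(\mathcal K)$ with $\mathcal K$ a real Hilbert space, $\operatorname{prox}_f(z)$ is the unique minimizer over $y\in\mathcal K$ of $f(y)+\frac12\|z-y\|^2$; $\operatorname{prox}_{\gamma\widetilde\varphi}$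 is taken in $\mathbb R\oplus\mathcal H$. *)

theory Defs
  imports "HOL-Analysis.Analysis"
begin

definition effective_domain :: "('a \<Rightarrow> ereal) \<Rightarrow> 'a set" where
  "effective_domain \<phi> = {x. \<phi> x < \<infinity>}"

(* The subtracted values lie in the effective domain, so for proper functions
   the ereal subtraction is never \<infinity> - \<infinity>. *)
definition recession :: "('a::real_vector \<Rightarrow> ereal) \<Rightarrow> 'a \<Rightarrow> ereal" where
  "recession \<phi> x = (SUP y \<in> effective_domain \<phi>. \<phi> (x + y) - \<phi> y)"

definition perspective :: "('a::real_vector \<Rightarrow> ereal) \<Rightarrow> real \<times> 'a \<Rightarrow> ereal" where
  "perspective \<phi> = (\<lambda>(\<sigma>, x).
     if \<sigma> > 0 then ereal \<sigma> * \<phi> (x /\<^sub>R \<sigma>)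
     else if \<sigma> = 0 then recession \<phi> x
     else \<infinity>)"

(* On real \<times> 'a the library norm is the one of the Hilbert direct sum. *)
definition prox ::
    "('a::{real_inner, complete_space} \<Rightarrow> ereal) \<Rightarrow> 'a \<Rightarrow> 'a" where
  "prox f z = (THE p. is_arg_min (\<lambda>y. f y + ereal (1 / 2 * (norm (z - y))\<^sup>2)) (\<lambda>_. True) p)"

end

(*
  Write h for the perspective of \<phi>.  It is positively homogeneous, and h is the support
  function of the set of all (u, v) with norm v \<le> 1 and u + \<epsilon> * norm v \<le> \<alpha>.  Hence (s, p) is the
  proximal point of (\<sigma>, x) as soon as (\<sigma>, x) = (s, p) + \<gamma> (u, v) for some (u, v) in
  that set with h (s, p) = u * s + inner v p.  In the five cases such a pair (u, v) is
  (\<sigma> / \<gamma>, x / \<gamma>);  (\<sigma> / \<gamma>, x / norm x);  (\<alpha> - \<epsilon>, x / norm x);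
  a point with u + \<epsilon> * norm v = \<alpha> and v parallel to x;  (\<alpha>, 0).
*)
theory Submission
  imports Defs
begin

text \<open>Fermat's rule: \<open>z - p\<close> is a subgradient of \<open>f\<close> at
  \<open>p\<close>. Added to the expansion of the quadratic around \<open>p\<close>, it makes the
  objective exceed its value at \<open>p\<close> by at least half the squared distance to
  \<open>p\<close>, which gives both minimality and the uniqueness that \<open>THE\<close>
  requires.\<close>

lemma prox_eqI:
  fixes z p :: "'a::{real_inner, complete_space}"
  assumes fp: "f p = ereal c"
    and subgrad: "\<And>y. ereal (c + inner (z - p) (y - p)) \<le> f y"
  shows "prox f z = p"
proof -
  let ?g = "\<lambda>y. f y + ereal (1 / 2 * (norm (z - y))\<^sup>2)"
  have grow: "?g p + ereal (1 / 2 * (norm (y - p))\<^sup>2) \<le> ?g y" for y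
  proof -
    have "c + 1 / 2 * (norm (z - p))\<^sup>2 + 1 / 2 * (norm (y - p))\<^sup>2
        = c + inner (z - p) (y - p) + 1 / 2 * (norm (z - y))\<^sup>2"
      unfolding power2_norm_eq_inner
      by (simp add: inner_diff_left inner_diff_right inner_commute field_simps)
    then have "?g p + ereal (1 / 2 * (norm (y - p))\<^sup>2)
        = ereal (c + inner (z - p) (y - p)) + ereal (1 / 2 * (norm (z - y))\<^sup>2)"
      by (simp add: fp)
    also have "\<dots> \<le> ?g y"
      by (intro add_right_mono subgrad)
    finally show ?thesis .
  qed
  have min: "?g p \<le> ?g y" for y
  proof -
    have "?g p \<le> ?g p + ereal (1 / 2 * (norm (y - p))\<^sup>2)"
      by (simp add: fp)
    then show ?thesis
      using grow order_trans by blast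
  qed
  have strict: "?g p < ?g y" if "y \<noteq> p" for y
  proof -
    \<comment> \<open>Finiteness of \<open>f p\<close> is what makes adding a positive real strict
      in \<open>ereal\<close>.\<close>
    have "?g p < ?g p + ereal (1 / 2 * (norm (y - p))\<^sup>2)"
      using that by (simp add: fp)
    then show ?thesis
      using grow less_le_trans by blast
  qed
  show ?thesis
    unfolding prox_def
  proof (rule the_equality)
    show "is_arg_min ?g (\<lambda>_. True) p"
      using min by (auto simp: is_arg_min_def not_less)
  next
    fix q assume "is_arg_min ?g (\<lambda>_. True) q"
    then show "q = p"
      using strict[of q] by (auto simp: is_arg_min_def)
  qed
qed

text \<open>The function is 1-Lipschitz, which bounds every difference quotient by
  \<open>norm x\<close>; outside the ball of radius \<open>\<epsilon>\<close> it grows radially with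
  slope exactly 1.\<close>

lemma recession_max_norm:
  fixes x :: "'a::real_normed_vector"
  assumes "\<epsilon> \<ge> 0"
  shows "recession (\<lambda>x. ereal (\<alpha> + max (norm x - \<epsilon>) 0)) x = ereal (norm x)"
proof -
  let ?\<phi> = "\<lambda>x::'a. ereal (\<alpha> + max (norm x - \<epsilon>) 0)"
  \<comment> \<open>The function is finite everywhere, so its effective domain is the whole
    space.\<close>
  have "(SUP y. ?\<phi> (x + y) - ?\<phi> y) = ereal (norm x)"
  proof (rule antisym)
    show "(SUP y. ?\<phi> (x + y) - ?\<phi> y) \<le> ereal (norm x)"
    proof (rule SUP_least)
      fix y
      have "max (norm (x + y) - \<epsilon>) 0 - max (norm y - \<epsilon>) 0 \<le> norm x"
        using norm_triangle_ineq[of x y] norm_ge_zero[of x] by linarith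
      then show "?\<phi> (x + y) - ?\<phi> y \<le> ereal (norm x)"
        by simp
    qed
  next
    \<comment> \<open>The supremum is attained at the point of norm \<open>\<epsilon>\<close> in direction \<open>x\<close>.\<close>
    let ?y = "(\<epsilon> / norm x) *\<^sub>R x"
    have "norm x \<le> max (norm (x + ?y) - \<epsilon>) 0 - max (norm ?y - \<epsilon>) 0"
    proof (cases "x = 0")
      case False
      have "x + ?y = (1 + \<epsilon> / norm x) *\<^sub>R x"
        by (simp add: scaleR_add_left)
      then have "norm (x + ?y) = \<bar>1 + \<epsilon> / norm x\<bar> * norm x"
        by (metis norm_scaleR)
      also have "\<dots> = norm x + \<epsilon>"
        using False assms by (simp add: field_simps)
      finally show ?thesis
        using False assms by simp
    qed (use assms in simp)
    then have "ereal (norm x) \<le> ?\<phi> (x + ?y) - ?\<phi> ?y"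
      by simp
    also have "\<dots> \<le> (SUP y. ?\<phi> (x + y) - ?\<phi> y)"
      by (rule SUP_upper) simp
    finally show "ereal (norm x) \<le> (SUP y. ?\<phi> (x + y) - ?\<phi> y)" .
  qed
  then show ?thesis
    by (simp add: recession_def effective_domain_def)
qed

lemma perspective_max_norm:
  fixes \<alpha> \<epsilon> :: real
  assumes "\<epsilon> \<ge> 0"
  shows "perspective (\<lambda>x::'a::real_normed_vector. ereal (\<alpha> + max (norm x - \<epsilon>) 0)) =
    (\<lambda>(\<sigma>, x). if \<sigma> \<ge> 0 then ereal (\<alpha> * \<sigma> + max (norm x - \<epsilon> * \<sigma>) 0) else \<infinity>)"
proof (intro ext, clarify)
  fix \<sigma> :: real and x :: 'a
  let ?\<phi> = "\<lambda>x::'a. ereal (\<alpha> + max (norm x - \<epsilon>) 0)"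
  consider "\<sigma> > 0" | "\<sigma> = 0" | "\<sigma> < 0"
    by linarith
  then show "perspective ?\<phi> (\<sigma>, x) =
      (if \<sigma> \<ge> 0 then ereal (\<alpha> * \<sigma> + max (norm x - \<epsilon> * \<sigma>) 0) else \<infinity>)"
  proof cases
    case 1
    then have "\<sigma> * (\<alpha> + max (norm x / \<sigma> - \<epsilon>) 0) = \<alpha> * \<sigma> + max (norm x - \<epsilon> * \<sigma>) 0"
      by (auto simp: max_def field_simps)
    then show ?thesis
      using 1 by (simp add: perspective_def divide_inverse mult.commute)
  next
    case 2
    then show ?thesis
      by (simp add: perspective_def recession_max_norm[OF assms])
  next
    case 3
    then show ?thesis
      by (simp add: perspective_def)
  qed
qed

text \<open>A certificate shared by all five cases: by \<open>touch\<close>, the linear form given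
  by \<open>(u, v)\<close> minorizes the perspective with equality at \<open>(s, p)\<close>. It is
  therefore a subgradient there, and the residual \<open>(\<sigma>, x) - (s, p)\<close> is
  \<open>\<gamma>\<close> times it.\<close>

lemma prox_perspective_max_norm:
  fixes p v x :: "'a::{real_inner, complete_space}"
    and \<alpha> \<epsilon> \<gamma> \<sigma> s u :: real
  assumes "\<epsilon> \<ge> 0" "\<gamma> > 0"
    and s: "s \<ge> 0"
    and v: "norm v \<le> 1" and uv: "u + \<epsilon> * norm v \<le> \<alpha>"
    and touch: "\<alpha> * s + max (norm p - \<epsilon> * s) 0 = u * s + inner v p"
    and \<sigma>: "\<sigma> = s + \<gamma> * u" and x: "x = p + \<gamma> *\<^sub>R v"
  shows "prox (\<lambda>z. ereal \<gamma> * perspective (\<lambda>x. ereal (\<alpha> + max (norm x - \<epsilon>) 0)) z) (\<sigma>, x) = (s, p)"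
proof -
  let ?\<phi> = "\<lambda>x::'a. ereal (\<alpha> + max (norm x - \<epsilon>) 0)"
  have support: "u * t + inner v y \<le> \<alpha> * t + max (norm y - \<epsilon> * t) 0"
    if "t \<ge> 0" for t and y :: 'a
  proof -
    \<comment> \<open>Split \<open>norm v * norm y\<close> as
      \<open>norm v * (norm y - \<epsilon> * t)\<close> plus \<open>\<epsilon> * norm v * t\<close>:
      the first term is absorbed by the maximum, the second by the slack in
      \<open>uv\<close>.\<close>
    have "inner v y \<le> norm v * norm y"
      by (rule norm_cauchy_schwarz)
    moreover have "u * t \<le> (\<alpha> - \<epsilon> * norm v) * t"
      using uv that by (intro mult_right_mono) auto
    moreover have "norm v * (norm y - \<epsilon> * t) \<le> norm v * max (norm y - \<epsilon> * t) 0"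
      by (intro mult_left_mono) auto
    moreover have "norm v * max (norm y - \<epsilon> * t) 0 \<le> max (norm y - \<epsilon> * t) 0"
      using v by (intro mult_left_le_one_le) auto
    ultimately show ?thesis
      by (simp add: algebra_simps)
  qed
  show ?thesis
  proof (rule prox_eqI)
    show "ereal \<gamma> * perspective ?\<phi> (s, p) = ereal (\<gamma> * (u * s + inner v p))"
      using s touch by (simp add: perspective_max_norm[OF \<open>\<epsilon> \<ge> 0\<close>])
  next
    fix w :: "real \<times> 'a"
    obtain t y where w: "w = (t, y)"
      by (cases w)
    show "ereal (\<gamma> * (u * s + inner v p) + inner ((\<sigma>, x) - (s, p)) (w - (s, p)))
        \<le> ereal \<gamma> * perspective ?\<phi> w"
    proof (cases "t \<ge> 0")
      case True
      \<comment> \<open>The terms in \<open>(s, p)\<close> cancel: the affine minorant is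
        linear.\<close>
      have "\<gamma> * (u * s + inner v p) + inner ((\<sigma>, x) - (s, p)) (w - (s, p))
          = \<gamma> * (u * t + inner v y)"
        by (simp add: w \<sigma> x inner_diff_right algebra_simps)
      also have "\<dots> \<le> \<gamma> * (\<alpha> * t + max (norm y - \<epsilon> * t) 0)"
        using support[OF True] \<open>\<gamma> > 0\<close> by simp
      finally show ?thesis
        using True by (simp add: w perspective_max_norm[OF \<open>\<epsilon> \<ge> 0\<close>])
    next
      case False
      then show ?thesis
        using \<open>\<gamma> > 0\<close> by (simp add: w perspective_max_norm[OF \<open>\<epsilon> \<ge> 0\<close>])
    qed
  qed
qed

theorem mainTheorem4:
  fixes \<alpha> \<epsilon> \<gamma> :: real
    and \<phi> :: "'a::{real_inner, complete_space} \<Rightarrow> ereal"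
  assumes "\<alpha> > 0" and "\<epsilon> > 0" and "\<gamma> > 0"
    and "\<phi> = (\<lambda>x. ereal (\<alpha> + max (norm x - \<epsilon>) 0))"
  shows "perspective \<phi> =
      (\<lambda>(\<sigma>, x). if \<sigma> \<ge> 0 then ereal (\<alpha> * \<sigma> + max (norm x - \<epsilon> * \<sigma>) 0) else \<infinity>)
    \<and> (\<forall>(\<sigma>::real) (x::'a).
        (\<sigma> + \<epsilon> * norm x \<le> \<gamma> * \<alpha> \<and> norm x \<le> \<gamma> \<longrightarrow>
          prox (\<lambda>z. ereal \<gamma> * perspective \<phi> z) (\<sigma>, x) = (0, 0))
      \<and> (\<sigma> \<le> \<gamma> * (\<alpha> - \<epsilon>) \<and> norm x > \<gamma> \<longrightarrow>
          prox (\<lambda>z. ereal \<gamma> * perspective \<phi> z) (\<sigma>, x) = (0, (1 - \<gamma> / norm x) *\<^sub>R x))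
      \<and> (\<sigma> > \<gamma> * (\<alpha> - \<epsilon>) \<and> norm x \<ge> \<epsilon> * \<sigma> + \<gamma> * (1 + \<epsilon> * (\<epsilon> - \<alpha>)) \<longrightarrow>
          prox (\<lambda>z. ereal \<gamma> * perspective \<phi> z) (\<sigma>, x) =
            (\<sigma> + \<gamma> * (\<epsilon> - \<alpha>), (1 - \<gamma> / norm x) *\<^sub>R x))
      \<and> (\<sigma> + \<epsilon> * norm x > \<gamma> * \<alpha> \<and> \<epsilon> * (\<sigma> - \<gamma> * \<alpha>) < norm x
            \<and> norm x < \<epsilon> * \<sigma> + \<gamma> * (1 + \<epsilon> * (\<epsilon> - \<alpha>)) \<longrightarrow>
          prox (\<lambda>z. ereal \<gamma> * perspective \<phi> z) (\<sigma>, x) =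
            ((\<sigma> + \<epsilon> * norm x - \<gamma> * \<alpha>) / (1 + \<epsilon>\<^sup>2)) *\<^sub>R (1, (\<epsilon> / norm x) *\<^sub>R x))
      \<and> (\<sigma> \<ge> \<gamma> * \<alpha> \<and> norm x \<le> \<epsilon> * (\<sigma> - \<gamma> * \<alpha>) \<longrightarrow>
          prox (\<lambda>z. ereal \<gamma> * perspective \<phi> z) (\<sigma>, x) = (\<sigma> - \<gamma> * \<alpha>, x)))"
proof -
  have \<phi>: "\<phi> = (\<lambda>x. ereal (\<alpha> + max (norm x - \<epsilon>) 0))"
    by fact
  have "\<epsilon> \<ge> 0"
    using \<open>\<epsilon> > 0\<close> by simp
  have main: "prox (\<lambda>z. ereal \<gamma> * perspective \<phi> z) (\<sigma>, x) = (s, p)"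
    if "s \<ge> 0" "norm v \<le> 1" "u + \<epsilon> * norm v \<le> \<alpha>"
      "\<alpha> * s + max (norm p - \<epsilon> * s) 0 = u * s + inner v p"
      "\<sigma> = s + \<gamma> * u" "x = p + \<gamma> *\<^sub>R v"
    for s u \<sigma> :: real and p v x :: 'a
    unfolding \<phi> using \<open>\<epsilon> \<ge> 0\<close> \<open>\<gamma> > 0\<close> that by (rule prox_perspective_max_norm)
  \<comment> \<open>Soft thresholding, common to (ii) and (iii): the dual vector is the unit vector
    along \<open>x\<close>, aligned with the shrunken point, so the inner product equals the
    norm.\<close>
  have shrink: "inner (x /\<^sub>R norm x) ((1 - \<gamma> / norm x) *\<^sub>R x) = norm x - \<gamma>"
    "norm ((1 - \<gamma> / norm x) *\<^sub>R x) = norm x - \<gamma>"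
    "x = (1 - \<gamma> / norm x) *\<^sub>R x + \<gamma> *\<^sub>R (x /\<^sub>R norm x)"
    if "norm x > \<gamma>" for x :: 'a
  proof -
    have "norm x > 0"
      using that \<open>\<gamma> > 0\<close> by linarith
    then show "inner (x /\<^sub>R norm x) ((1 - \<gamma> / norm x) *\<^sub>R x) = norm x - \<gamma>"
      by (simp add: dot_square_norm power2_eq_square field_simps)
    have "\<bar>1 - \<gamma> / norm x\<bar> = 1 - \<gamma> / norm x"
      using that \<open>norm x > 0\<close> by simp
    then show "norm ((1 - \<gamma> / norm x) *\<^sub>R x) = norm x - \<gamma>"
      using \<open>norm x > 0\<close> by (simp add: field_simps)
    show "x = (1 - \<gamma> / norm x) *\<^sub>R x + \<gamma> *\<^sub>R (x /\<^sub>R norm x)"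
      by (simp add: scaleR_diff_left divide_inverse)
  qed
  \<comment> \<open>At the origin both sides of the contact equation vanish; the hypotheses say that
    \<open>(\<sigma>, x)\<close> divided by \<open>\<gamma>\<close> is dual feasible.\<close>
  have i: "prox (\<lambda>z. ereal \<gamma> * perspective \<phi> z) (\<sigma>, x) = (0, 0)"
    if "\<sigma> + \<epsilon> * norm x \<le> \<gamma> * \<alpha>" "norm x \<le> \<gamma>" for \<sigma> :: real and x :: 'a
    by (rule main[where u = "\<sigma> / \<gamma>" and v = "x /\<^sub>R \<gamma>"])
      (use that \<open>\<gamma> > 0\<close> in \<open>auto simp: field_simps\<close>)
  have ii: "prox (\<lambda>z. ereal \<gamma> * perspective \<phi> z) (\<sigma>, x) = (0, (1 - \<gamma> / norm x) *\<^sub>R x)"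
    if "\<sigma> \<le> \<gamma> * (\<alpha> - \<epsilon>)" "norm x > \<gamma>" for \<sigma> :: real and x :: 'a
  proof (rule main[where u = "\<sigma> / \<gamma>" and v = "x /\<^sub>R norm x"])
    have "norm x > 0"
      using that \<open>\<gamma> > 0\<close> by linarith
    then show "\<sigma> / \<gamma> + \<epsilon> * norm (x /\<^sub>R norm x) \<le> \<alpha>" "norm (x /\<^sub>R norm x) \<le> 1"
      using that \<open>\<gamma> > 0\<close> by (simp_all add: field_simps)
    show "\<alpha> * 0 + max (norm ((1 - \<gamma> / norm x) *\<^sub>R x) - \<epsilon> * 0) 0
        = \<sigma> / \<gamma> * 0 + inner (x /\<^sub>R norm x) ((1 - \<gamma> / norm x) *\<^sub>R x)"
      unfolding shrink(1,2)[OF that(2)] using that(2) by simp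
    show "x = (1 - \<gamma> / norm x) *\<^sub>R x + \<gamma> *\<^sub>R (x /\<^sub>R norm x)"
      by (rule shrink(3)[OF that(2)])
  qed (use \<open>\<gamma> > 0\<close> in simp_all)
  have iii: "prox (\<lambda>z. ereal \<gamma> * perspective \<phi> z) (\<sigma>, x) =
      (\<sigma> + \<gamma> * (\<epsilon> - \<alpha>), (1 - \<gamma> / norm x) *\<^sub>R x)"
    if "\<sigma> > \<gamma> * (\<alpha> - \<epsilon>)" "norm x \<ge> \<epsilon> * \<sigma> + \<gamma> * (1 + \<epsilon> * (\<epsilon> - \<alpha>))"
    for \<sigma> :: real and x :: 'a
  proof (rule main[where u = "\<alpha> - \<epsilon>" and v = "x /\<^sub>R norm x"])
    let ?s = "\<sigma> + \<gamma> * (\<epsilon> - \<alpha>)"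
    have s: "?s > 0"
      using that(1) by (simp add: algebra_simps)
    then have "\<epsilon> * ?s > 0"
      using \<open>\<epsilon> > 0\<close> by simp
    \<comment> \<open>This is \<open>norm p \<ge> \<epsilon> * s\<close> for the candidate point,
      which puts the maximum on its linear branch.\<close>
    moreover have xs: "norm x - \<gamma> \<ge> \<epsilon> * ?s"
      using that(2) by (simp add: algebra_simps)
    ultimately have x\<gamma>: "norm x > \<gamma>"
      by linarith
    then have "norm x > 0"
      using \<open>\<gamma> > 0\<close> by linarith
    then show "\<alpha> - \<epsilon> + \<epsilon> * norm (x /\<^sub>R norm x) \<le> \<alpha>" "norm (x /\<^sub>R norm x) \<le> 1"
      by simp_all
    show "\<alpha> * ?s + max (norm ((1 - \<gamma> / norm x) *\<^sub>R x) - \<epsilon> * ?s) 0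
        = (\<alpha> - \<epsilon>) * ?s + inner (x /\<^sub>R norm x) ((1 - \<gamma> / norm x) *\<^sub>R x)"
      unfolding shrink(1,2)[OF x\<gamma>] using xs by (simp add: left_diff_distrib)
    show "x = (1 - \<gamma> / norm x) *\<^sub>R x + \<gamma> *\<^sub>R (x /\<^sub>R norm x)"
      by (rule shrink(3)[OF x\<gamma>])
    show "?s \<ge> 0" "\<sigma> = ?s + \<gamma> * (\<alpha> - \<epsilon>)"
      using s by (simp_all add: algebra_simps)
  qed
  have iv: "prox (\<lambda>z. ereal \<gamma> * perspective \<phi> z) (\<sigma>, x) =
      ((\<sigma> + \<epsilon> * norm x - \<gamma> * \<alpha>) / (1 + \<epsilon>\<^sup>2)) *\<^sub>R (1, (\<epsilon> / norm x) *\<^sub>R x)"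
    if pos: "\<sigma> + \<epsilon> * norm x > \<gamma> * \<alpha>" and lo: "\<epsilon> * (\<sigma> - \<gamma> * \<alpha>) < norm x"
      and hi: "norm x < \<epsilon> * \<sigma> + \<gamma> * (1 + \<epsilon> * (\<epsilon> - \<alpha>))"
    for \<sigma> :: real and x :: 'a
  proof -
    \<comment> \<open>Here the solution lies on the kink \<open>norm p = \<epsilon> * s\<close> and
      the dual point on \<open>u + \<epsilon> * r = \<alpha>\<close>. Eliminating \<open>r\<close>
      from \<open>norm x = \<epsilon> * s + \<gamma> * r\<close> and
      \<open>\<sigma> = s + \<gamma> * u\<close> yields this value.\<close>
    define s where "s = (\<sigma> + \<epsilon> * norm x - \<gamma> * \<alpha>) / (1 + \<epsilon>\<^sup>2)"
    \<comment> \<open>The norm of the dual variable \<open>v\<close>.\<close>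
    define r where "r = (norm x - \<epsilon> * s) / \<gamma>"
    have E: "1 + \<epsilon>\<^sup>2 > 0"
      by (simp add: add_pos_nonneg)
    have "s * (1 + \<epsilon>\<^sup>2) = \<sigma> + \<epsilon> * norm x - \<gamma> * \<alpha>"
      using E by (simp add: s_def)
    then have sE: "s + \<epsilon> * (\<epsilon> * s) = \<sigma> + \<epsilon> * norm x - \<gamma> * \<alpha>"
      by (simp add: power2_eq_square algebra_simps)
    have "s > 0"
      using pos E by (simp add: s_def)
    have "x \<noteq> 0"
    proof
      assume "x = 0"
      then show False
        using pos lo \<open>\<epsilon> > 0\<close> by (simp add: mult_less_0_iff)
    qed
    have \<gamma>r: "\<gamma> * r = norm x - \<epsilon> * s"
      using \<open>\<gamma> > 0\<close> by (simp add: r_def)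
    \<comment> \<open>Clearing the denominator of \<open>s\<close> turns \<open>lo\<close> into
      \<open>r > 0\<close> and \<open>hi\<close> into an upper bound 1 for \<open>r\<close>.\<close>
    have "\<gamma> * r * (1 + \<epsilon>\<^sup>2) = norm x + \<epsilon> * (\<epsilon> * norm x) - \<epsilon> * (s + \<epsilon> * (\<epsilon> * s))"
      unfolding \<gamma>r by (simp add: power2_eq_square algebra_simps)
    then have rE: "\<gamma> * r * (1 + \<epsilon>\<^sup>2) = norm x - \<epsilon> * (\<sigma> - \<gamma> * \<alpha>)"
      unfolding sE by (simp add: algebra_simps)
    then have "r > 0"
      using lo E \<open>\<gamma> > 0\<close> by (smt (verit) zero_less_mult_iff)
    have "\<gamma> * r * (1 + \<epsilon>\<^sup>2) \<le> \<gamma> * 1 * (1 + \<epsilon>\<^sup>2)"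
      unfolding rE using hi by (simp add: power2_eq_square algebra_simps)
    then have "r \<le> 1"
      using E \<open>\<gamma> > 0\<close> by simp
    define u where "u = \<alpha> - \<epsilon> * r"
    have \<gamma>u: "\<gamma> * u = \<gamma> * \<alpha> - \<epsilon> * (norm x - \<epsilon> * s)"
      unfolding u_def by (metis \<gamma>r mult.left_commute right_diff_distrib)
    have "prox (\<lambda>z. ereal \<gamma> * perspective \<phi> z) (\<sigma>, x) = (s, (\<epsilon> * s / norm x) *\<^sub>R x)"
    proof (rule main[where u = u and v = "(r / norm x) *\<^sub>R x"])
      show "norm ((r / norm x) *\<^sub>R x) \<le> 1" "u + \<epsilon> * norm ((r / norm x) *\<^sub>R x) \<le> \<alpha>"
        using \<open>r > 0\<close> \<open>r \<le> 1\<close> \<open>x \<noteq> 0\<close> by (simp_all add: u_def)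
      \<comment> \<open>On the kink the maximum is zero, and this product supplies exactly the
        difference \<open>(\<alpha> - u) * s\<close>.\<close>
      have "inner ((r / norm x) *\<^sub>R x) ((\<epsilon> * s / norm x) *\<^sub>R x) = r * (\<epsilon> * s)"
        using \<open>x \<noteq> 0\<close> by (simp add: dot_square_norm power2_eq_square)
      then show "\<alpha> * s + max (norm ((\<epsilon> * s / norm x) *\<^sub>R x) - \<epsilon> * s) 0
          = u * s + inner ((r / norm x) *\<^sub>R x) ((\<epsilon> * s / norm x) *\<^sub>R x)"
        using \<open>x \<noteq> 0\<close> \<open>s > 0\<close> \<open>\<epsilon> > 0\<close> by (simp add: u_def algebra_simps)
      show "\<sigma> = s + \<gamma> * u"
        unfolding \<gamma>u using sE by (simp add: algebra_simps)
      have "\<epsilon> * s / norm x + \<gamma> * (r / norm x) = 1"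
        using \<open>x \<noteq> 0\<close> \<open>\<gamma> > 0\<close> by (simp add: r_def field_simps)
      then show "x = (\<epsilon> * s / norm x) *\<^sub>R x + \<gamma> *\<^sub>R ((r / norm x) *\<^sub>R x)"
        by (metis scaleR_add_left scaleR_one scaleR_scaleR)
    qed (use \<open>s > 0\<close> in simp)
    then show ?thesis
      unfolding s_def[symmetric] by (simp add: mult.commute)
  qed
  \<comment> \<open>The hypothesis on \<open>norm x\<close> makes the maximum vanish at the
    candidate, leaving the linear function with gradient \<open>(\<alpha>, 0)\<close>.\<close>
  have v: "prox (\<lambda>z. ereal \<gamma> * perspective \<phi> z) (\<sigma>, x) = (\<sigma> - \<gamma> * \<alpha>, x)"
    if "\<sigma> \<ge> \<gamma> * \<alpha>" "norm x \<le> \<epsilon> * (\<sigma> - \<gamma> * \<alpha>)" for \<sigma> :: real and x :: 'a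
    by (rule main[where u = \<alpha> and v = 0]) (use that in simp_all)
  show ?thesis
    using perspective_max_norm[OF \<open>\<epsilon> \<ge> 0\<close>, of \<alpha>] i ii iii iv v
    unfolding \<phi> by simp
qed

end
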